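(* Let $p$ be a prime, let $\mathcal{F}$ be a (not necessarily saturated) fusion system over a finite $p$-group $S$, and let $Q\leq S$ be a large subgroup of $\mathcal{F}$. (a) The subgroup $O_p(N_{\mathcal{F}}(Q))$ is large in $\mathcal{F}$. (b) For every $1\neq U\leq Z(Q)$, we have $Q\unlhd N_{\mathcal{F}}(U)$. (c) We have $Q\unlhd S$. (d) If $R\leq S$ is large in $\mathcal{F}$, then $QR$ is large in $\mathcal{F}$.
   Context: For a fusion system $\mathcal{F}$ over $S$ and $P\leq S$, $N_{\mathcal{F}}(P)$ is the fusion system over $N_S(P)$ whose morphisms are the $\mathcal{F}$-morphisms $\phi\colon X\to Y$ ($X,Y\leq N_S(P)$) that extend to some $\hat\phi\in\mathrm{Hom}_{\mathcal{F}}(XP,YP)$ with $P\hat\phi=P$. For a fusion system $\mathcal{E}$ over $T$, $P\leq T$ is normal in $\mathcal{E}$ ($P\unlhd\mathcal{E}$) if $\mathcal{E}=N_{\mathcal{E}}(P)$, and $O_p(\mathcal{E})$ is the largest subgroup of $T$ normal in $\mathcal{E}$. A subgroup $Q\leq S$ is large in $\mathcal{F}$ if $C_S(Q)\leq Q$ and $N_{\mathcal{F}}(U)\subseteq N_{\mathcal{F}}(Q)$ for all $1\neq U\leq Z(Q)$. *)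

theory Defs
  imports "HOL-Algebra.Group_Action" "HOL-Computational_Algebra.Primes"
begin

definition finite_p_group :: "nat \<Rightarrow> ('a, 'b) monoid_scheme \<Rightarrow> bool" where
  "finite_p_group p S \<longleftrightarrow>
     group S \<and> finite (carrier S) \<and> (\<exists>n. order S = p ^ n)"

definition centralizer :: "('a, 'b) monoid_scheme \<Rightarrow> 'a set \<Rightarrow> 'a set" where
  "centralizer G A = {g \<in> carrier G. \<forall>a\<in>A. g \<otimes>\<^bsub>G\<^esub> a = a \<otimes>\<^bsub>G\<^esub> g}"

definition center_of :: "('a, 'b) monoid_scheme \<Rightarrow> 'a set \<Rightarrow> 'a set" where
  "center_of G H = H \<inter> centralizer G H"

text \<open>
  A morphism from P to Q is encoded as a function that is undefined outside P
  (\<^term>\<open>extensional\<close>), and the set of morphisms is required to be empty unless both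
  arguments are subgroups of the underlying group. Thus two fusion systems are equal as
  categories iff the records are equal.
\<close>

record 'a fusion =
  grp :: "'a monoid"
  Mor :: "'a set \<Rightarrow> 'a set \<Rightarrow> ('a \<Rightarrow> 'a) set"

definition inj_homs :: "('a, 'b) monoid_scheme \<Rightarrow> 'a set \<Rightarrow> 'a set \<Rightarrow> ('a \<Rightarrow> 'a) set" where
  "inj_homs S P Q =
     {f \<in> hom (S\<lparr>carrier := P\<rparr>) (S\<lparr>carrier := Q\<rparr>). f \<in> extensional P \<and> inj_on f P}"

definition conj_homs :: "('a, 'b) monoid_scheme \<Rightarrow> 'a set \<Rightarrow> 'a set \<Rightarrow> ('a \<Rightarrow> 'a) set" where
  "conj_homs S P Q =
     {restrict (\<lambda>x. inv\<^bsub>S\<^esub> s \<otimes>\<^bsub>S\<^esub> x \<otimes>\<^bsub>S\<^esub> s) P | s.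
        s \<in> carrier S \<and> (\<forall>x\<in>P. inv\<^bsub>S\<^esub> s \<otimes>\<^bsub>S\<^esub> x \<otimes>\<^bsub>S\<^esub> s \<in> Q)}"

text \<open>
  Identities and inclusions are among the conjugation maps (take s = 1). The last axiom says
  that each morphism is an isomorphism onto its image followed by an inclusion.
  Saturation is not required.
\<close>

definition fusion_system_over :: "nat \<Rightarrow> 'a monoid \<Rightarrow> 'a fusion \<Rightarrow> bool" where
  "fusion_system_over p S F \<longleftrightarrow>
     finite_p_group p S \<and> grp F = S \<and>
     (\<forall>P Q. \<not> (subgroup P S \<and> subgroup Q S) \<longrightarrow> Mor F P Q = {}) \<and>
     (\<forall>P Q. subgroup P S \<longrightarrow> subgroup Q S \<longrightarrow>
        conj_homs S P Q \<subseteq> Mor F P Q \<and> Mor F P Q \<subseteq> inj_homs S P Q) \<and>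
     (\<forall>P Q R. \<forall>f \<in> Mor F P Q. \<forall>g \<in> Mor F Q R. compose P g f \<in> Mor F P R) \<and>
     (\<forall>P Q. \<forall>f \<in> Mor F P Q.
        f \<in> Mor F P (f ` P) \<and> restrict (inv_into P f) (f ` P) \<in> Mor F (f ` P) P)"

text \<open>Inclusion of fusion systems over subgroups of a common group, as subcategories.\<close>

definition subsystem :: "'a fusion \<Rightarrow> 'a fusion \<Rightarrow> bool" where
  "subsystem E F \<longleftrightarrow>
     subgroup (carrier (grp E)) (grp F) \<and>
     grp E = (grp F)\<lparr>carrier := carrier (grp E)\<rparr> \<and>
     (\<forall>X Y. Mor E X Y \<subseteq> Mor F X Y)"

definition normalizer_fs :: "'a fusion \<Rightarrow> 'a set \<Rightarrow> 'a fusion" where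
  "normalizer_fs F P =
     (let S = grp F; N = S\<lparr>carrier := normalizer S P\<rparr> in
      \<lparr>grp = N,
       Mor = (\<lambda>X Y. {f \<in> Mor F X Y. subgroup X N \<and> subgroup Y N \<and>
          (\<exists>h \<in> Mor F (X <#>\<^bsub>S\<^esub> P) (Y <#>\<^bsub>S\<^esub> P). (\<forall>x\<in>X. h x = f x) \<and> h ` P = P)})\<rparr>)"

definition normal_in_fs :: "'a set \<Rightarrow> 'a fusion \<Rightarrow> bool" where
  "normal_in_fs P E \<longleftrightarrow> subgroup P (grp E) \<and> E = normalizer_fs E P"

text \<open>\<^term>\<open>Greatest\<close> is taken with respect to inclusion of sets.\<close>

definition O_p :: "'a fusion \<Rightarrow> 'a set" where
  "O_p E = (GREATEST P. normal_in_fs P E)"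

definition large :: "'a fusion \<Rightarrow> 'a set \<Rightarrow> bool" where
  "large F Q \<longleftrightarrow>
     subgroup Q (grp F) \<and> centralizer (grp F) Q \<subseteq> Q \<and>
     (\<forall>U. subgroup U (grp F) \<longrightarrow> U \<noteq> {\<one>\<^bsub>grp F\<^esub>} \<longrightarrow> U \<subseteq> center_of (grp F) Q \<longrightarrow>
        subsystem (normalizer_fs F U) (normalizer_fs F Q))"

end

theory Submission
  imports Defs "HOL-Algebra.SndIsomorphismGrp" "HOL-Algebra.Zassenhaus"
begin

text \<open>
  Since \<open>C\<^sub>S(Q) \<le> Q\<close>, the centre of \<open>S\<close> lies in the centre of \<open>Q\<close>; it is nontrivial unless
  \<open>S = 1\<close>, so largeness applied to \<open>U = Z(S)\<close> gives \<open>S = N\<^sub>S(U) \<le> N\<^sub>S(Q)\<close>. A morphism of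
  \<open>N\<^sub>F(U)\<close> is first extended to \<open>XU\<close>, stabilising \<open>U\<close>, and only then, by largeness, to \<open>XQ\<close>;
  the second extension still stabilises \<open>U\<close>, whence \<open>Q\<close> is normal in \<open>N\<^sub>F(U)\<close>. A product of two
  normal subgroups of a fusion system is again normal, because extensions can be iterated.
  This yields the existence of \<open>O\<^sub>p\<close> and, together with
  \<open>C\<^sub>S(M) \<le> C\<^sub>S(Q) \<le> Q \<le> M\<close> for every overgroup \<open>M\<close> of \<open>Q\<close>, the two largeness claims.
\<close>

section \<open>Finite groups and normalizers\<close>

lemma (in group) subgroup_normalizer:
  assumes "subgroup P G"
  shows "subgroup (normalizer G P) G"
  using assms normalizer_imp_subgroup subgroup.subset by blast

text \<open>Translates between the equality of carriers contained in E = N_E(P) and the normality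
  that products of subgroups need.\<close>

lemma (in group) normalizer_eq_carrier_iff:
  assumes "subgroup P G"
  shows "normalizer G P = carrier G \<longleftrightarrow> P \<lhd> G"
proof
  assume "normalizer G P = carrier G"
  with subgroup_in_normalizer[OF assms] show "P \<lhd> G" by simp
next
  assume "P \<lhd> G"
  then have "subgroup (carrier G) (G\<lparr>carrier := normalizer G P\<rparr>)"
    using normal_imp_subgroup_normalizer[OF subgroup_self, of P] by simp
  then have "carrier G \<subseteq> normalizer G P"
    using subgroup.subset by fastforce
  then show "normalizer G P = carrier G"
    using subgroup.subset[OF subgroup_normalizer[OF assms]] by auto
qed

section \<open>Products of subgroups and normality\<close>

lemma (in group) set_mult_absorb_right:
  assumes "subgroup X G" "P \<subseteq> X" "\<one> \<in> P"
  shows "X <#> P = X"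
proof
  show "X <#> P \<subseteq> X"
    using assms subgroup.m_closed[OF assms(1)] by (auto simp: set_mult_def)
  show "X \<subseteq> X <#> P"
    using assms subgroup.subset[OF assms(1)] by (force simp: set_mult_def)
qed

lemma (in group) set_mult_absorb_left:
  assumes "subgroup X G" "P \<subseteq> X" "\<one> \<in> P"
  shows "P <#> X = X"
proof
  show "P <#> X \<subseteq> X"
    using assms subgroup.m_closed[OF assms(1)] by (auto simp: set_mult_def)
  show "X \<subseteq> P <#> X"
    using assms subgroup.subset[OF assms(1)] by (force simp: set_mult_def)
qed

lemma (in group) subset_set_mult_left:
  assumes "X \<subseteq> carrier G" "subgroup P G"
  shows "X \<subseteq> X <#> P"
  using assms subgroup.one_closed[OF assms(2)] by (force simp: set_mult_def)

lemma (in group) subset_set_mult_right: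
  assumes "P \<subseteq> carrier G" "subgroup X G"
  shows "P \<subseteq> X <#> P"
  using assms subgroup.one_closed[OF assms(2)] by (force simp: set_mult_def)

lemma (in group) subgroup_set_mult_normal:
  assumes "subgroup X G" "P \<lhd> G"
  shows "subgroup (X <#> P) G"
proof -
  interpret second_isomorphism_grp P G X
    using assms by (simp add: second_isomorphism_grp_def second_isomorphism_grp_axioms_def)
  show ?thesis
    using normal_set_mult_subgroup commut_normal[OF assms] by simp
qed

lemma (in group) normal_set_mult:
  assumes "P \<lhd> G" "R \<lhd> G"
  shows "P <#> R \<lhd> G"
  unfolding normal_inv_iff
proof (intro conjI ballI)
  have P: "subgroup P G" and R: "subgroup R G"
    using assms by (auto simp: normal_inv_iff)
  show "subgroup (P <#> R) G"
    using subgroup_set_mult_normal[OF P assms(2)] .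
  fix x h assume x: "x \<in> carrier G" and "h \<in> P <#> R"
  then obtain a b where a: "a \<in> P" and b: "b \<in> R" and h: "h = a \<otimes> b"
    by (auto simp: set_mult_def)
  have G: "a \<in> carrier G" "b \<in> carrier G"
    using a b P R subgroup.subset by blast+
  \<comment> \<open>Conjugation by \<open>x\<close> is multiplicative, so it acts on the two factors
    separately.\<close>
  have "x \<otimes> h \<otimes> inv x = (x \<otimes> a \<otimes> inv x) \<otimes> (x \<otimes> b \<otimes> inv x)"
    using x G by (simp add: h m_assoc inv_solve_left)
  moreover have "x \<otimes> a \<otimes> inv x \<in> P" "x \<otimes> b \<otimes> inv x \<in> R"
    using assms x a b by (auto simp: normal_inv_iff)
  ultimately show "x \<otimes> h \<otimes> inv x \<in> P <#> R"
    by (auto simp: set_mult_def)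
qed

section \<open>Centralizers and the nontrivial centre of a p-group\<close>

lemma (in group) subgroup_centralizer:
  assumes "A \<subseteq> carrier G"
  shows "subgroup (centralizer G A) G"
proof (rule subgroupI)
  show "centralizer G A \<subseteq> carrier G" "centralizer G A \<noteq> {}"
    using assms by (auto simp: centralizer_def intro!: exI[of _ \<one>])
next
  fix g assume "g \<in> centralizer G A"
  then have g: "g \<in> carrier G" "\<And>a. a \<in> A \<Longrightarrow> g \<otimes> a = a \<otimes> g"
    by (auto simp: centralizer_def)
  have "inv g \<otimes> a = a \<otimes> inv g" if "a \<in> A" for a
  proof -
    have a: "a \<in> carrier G" using assms that by auto
    have "inv g \<otimes> a = inv g \<otimes> (a \<otimes> g) \<otimes> inv g"
      using g(1) a by (simp add: m_assoc)
    also have "\<dots> = inv g \<otimes> (g \<otimes> a) \<otimes> inv g"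
      using g(2)[OF that] by simp
    also have "\<dots> = a \<otimes> inv g"
      using g(1) a by (simp add: m_assoc[symmetric])
    finally show ?thesis .
  qed
  then show "inv g \<in> centralizer G A"
    using g by (simp add: centralizer_def)
next
  fix g h assume "g \<in> centralizer G A" "h \<in> centralizer G A"
  then have gh: "g \<in> carrier G" "h \<in> carrier G"
      "\<And>a. a \<in> A \<Longrightarrow> g \<otimes> a = a \<otimes> g" "\<And>a. a \<in> A \<Longrightarrow> h \<otimes> a = a \<otimes> h"
    by (auto simp: centralizer_def)
  have "g \<otimes> h \<otimes> a = a \<otimes> (g \<otimes> h)" if "a \<in> A" for a
  proof -
    have a: "a \<in> carrier G" using assms that by auto
    have "g \<otimes> h \<otimes> a = g \<otimes> a \<otimes> h"
      using gh(1,2) gh(4)[OF that] a by (simp add: m_assoc)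
    also have "\<dots> = a \<otimes> g \<otimes> h"
      using gh(3)[OF that] by simp
    also have "\<dots> = a \<otimes> (g \<otimes> h)"
      using gh(1,2) a by (simp add: m_assoc)
    finally show ?thesis .
  qed
  then show "g \<otimes> h \<in> centralizer G A"
    using gh by (simp add: centralizer_def)
qed

text \<open>Conjugation fixes every element of U. Serves twice: for the centre of S inside S, and
  for U \<le> Z(Q) inside the group Q.\<close>

lemma (in group) normal_if_centralized:
  assumes "subgroup U G" "U \<subseteq> centralizer G (carrier G)"
  shows "U \<lhd> G"
  unfolding normal_inv_iff
proof (intro conjI ballI)
  fix x u assume x: "x \<in> carrier G" and "u \<in> U"
  then have u: "u \<in> U" "u \<in> carrier G" "u \<otimes> x = x \<otimes> u"
    using assms(2) by (auto simp: centralizer_def)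
  have "x \<otimes> u \<otimes> inv x = u \<otimes> x \<otimes> inv x"
    using u by simp
  also have "\<dots> = u"
    using u(2) x by (simp add: m_assoc)
  finally show "x \<otimes> u \<otimes> inv x \<in> U"
    using u by simp
qed (fact assms)

text \<open>
  The orbits of the conjugation action have \<open>p\<close>-power size. If \<open>{\<one>}\<close> were the only singleton
  orbit, the order of the group would be \<open>1\<close> modulo \<open>p\<close>.
\<close>

lemma finite_p_group_nontrivial_center:
  fixes G (structure)
  assumes "prime p" "finite_p_group p G" "carrier G \<noteq> {\<one>}"
  shows "centralizer G (carrier G) \<noteq> {\<one>}"
proof
  assume triv: "centralizer G (carrier G) = {\<one>}"
  interpret group G using assms(2) by (simp add: finite_p_group_def)
  have fin: "finite (carrier G)" using assms(2) by (simp add: finite_p_group_def)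
  obtain n where n: "order G = p ^ n" using assms(2) by (auto simp: finite_p_group_def)
  define \<phi> where "\<phi> = (\<lambda>g. (\<lambda>h \<in> carrier G. g \<otimes> h \<otimes> (inv g)))"
  interpret act: group_action G "carrier G" \<phi>
    unfolding \<phi>_def by (rule action_by_conjugation)
  let ?Orb = "orbits G (carrier G) \<phi>"
  have part: "partition (carrier G) ?Orb" by (rule act.orbit_partition)
  have Orb_fin: "finite ?Orb"
    using fin by (simp add: orbits_def Setcompr_eq_image)
  have one: "orbit G \<phi> \<one> = {\<one>}"
    by (auto simp: orbit_def \<phi>_def intro!: exI[of _ \<one>])
  have one_in: "{\<one>} \<in> ?Orb"
    using one by (auto simp: orbits_def)
  have dvd: "p dvd card O'" if O': "O' \<in> ?Orb - {{\<one>}}" for O'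
  proof -
    obtain x where x: "x \<in> carrier G" and O'_eq: "O' = orbit G \<phi> x"
      using O' by (auto simp: orbits_def)
    have "card O' dvd p ^ n"
      using act.orbit_stabilizer_theorem[OF x] n O'_eq by (metis dvd_triv_left)
    then obtain k where k: "card O' = p ^ k"
      using divides_primepow_nat[OF assms(1)] by blast
    \<comment> \<open>A one-point orbit {x} means that x is central, so x = 1; but this orbit has
      been removed.\<close>
    have "k \<noteq> 0"
    proof
      assume "k = 0"
      then obtain y where "O' = {y}" using k by (auto simp: card_1_singleton_iff)
      moreover have "x \<in> O'" using act.orbit_refl[OF x] O'_eq by simp
      ultimately have O'_x: "O' = {x}" by simp
      have "x \<otimes> g = g \<otimes> x" if g: "g \<in> carrier G" for g
      proof -
        have "\<phi> g x \<in> O'" using g O'_eq by (auto simp: orbit_def)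
        then have "g \<otimes> x \<otimes> inv g = x" using O'_x x by (simp add: \<phi>_def)
        then have "x \<otimes> g = g \<otimes> x \<otimes> inv g \<otimes> g" by simp
        also have "\<dots> = g \<otimes> x" using g x by (simp add: m_assoc)
        finally show ?thesis .
      qed
      then have "x \<in> centralizer G (carrier G)" using x by (simp add: centralizer_def)
      then show False using triv O'_x O' by simp
    qed
    then show ?thesis using k by simp
  qed
  \<comment> \<open>Class equation: summing the constant 1 over the disjoint orbits counts the
    group.\<close>
  have "order G = (\<Sum>O'\<in>?Orb. card O')"
    using disjoint_sum[OF Orb_fin fin part, of "\<lambda>_. 1::nat"] by (simp add: order_def)
  also have "\<dots> = 1 + (\<Sum>O'\<in>?Orb - {{\<one>}}. card O')"
    using sum.remove[OF Orb_fin one_in, of card] by simp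
  finally have sum: "order G = 1 + (\<Sum>O'\<in>?Orb - {{\<one>}}. card O')" .
  \<comment> \<open>The group is nontrivial, so p divides its order and would have to divide the 1
    contributed by the orbit of the identity.\<close>
  have "n \<noteq> 0"
  proof
    assume "n = 0"
    then have "card (carrier G) = 1" using n by (simp add: order_def)
    then show False
      using assms(3) one_closed by (metis card_1_singletonE singletonD)
  qed
  then have "p dvd order G" using n by simp
  moreover have "p dvd (\<Sum>O'\<in>?Orb - {{\<one>}}. card O')"
    using dvd by (rule dvd_sum)
  ultimately have "p dvd 1"
    using sum by (metis dvd_add_left_iff)
  then show False using assms(1) by simp
qed

section \<open>Normal subgroups of fusion systems\<close>

text \<open>
  The only properties of a fusion system that matter below. Unlike \<^const>\<open>fusion_system_over\<close>, they
  are immediately inherited by normalizers.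
\<close>

locale hom_system = group "grp E" for E :: "'a fusion" +
  assumes Mor_subgroup: "f \<in> Mor E X Y \<Longrightarrow> subgroup X (grp E) \<and> subgroup Y (grp E)"
    and Mor_hom: "f \<in> Mor E X Y \<Longrightarrow>
      f \<in> hom ((grp E)\<lparr>carrier := X\<rparr>) ((grp E)\<lparr>carrier := Y\<rparr>)"

lemma fusion_system_over_imp_hom_system:
  assumes "fusion_system_over p S F"
  shows "hom_system F"
proof -
  have S: "grp F = S" "group S"
    using assms by (auto simp: fusion_system_over_def finite_p_group_def)
  have sub: "subgroup X S \<and> subgroup Y S" if "f \<in> Mor F X Y" for f X Y
    using assms that by (auto simp: fusion_system_over_def)
  have "f \<in> inj_homs S X Y" if "f \<in> Mor F X Y" for f X Y
    using assms that sub[OF that] unfolding fusion_system_over_def by blast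
  with S sub show ?thesis
    by (auto simp: hom_system_def hom_system_axioms_def inj_homs_def)
qed

section \<open>Normalizer systems and subsystems\<close>

lemma grp_normalizer_fs [simp]:
  "grp (normalizer_fs F P) = (grp F)\<lparr>carrier := normalizer (grp F) P\<rparr>"
  by (simp add: normalizer_fs_def Let_def)

lemma mem_Mor_normalizer_fs:
  "f \<in> Mor (normalizer_fs F P) X Y \<longleftrightarrow>
     f \<in> Mor F X Y \<and>
     subgroup X ((grp F)\<lparr>carrier := normalizer (grp F) P\<rparr>) \<and>
     subgroup Y ((grp F)\<lparr>carrier := normalizer (grp F) P\<rparr>) \<and>
     (\<exists>h \<in> Mor F (X <#>\<^bsub>grp F\<^esub> P) (Y <#>\<^bsub>grp F\<^esub> P). (\<forall>x\<in>X. h x = f x) \<and> h ` P = P)"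
  by (simp add: normalizer_fs_def Let_def)

text \<open>Chains the inclusions of N_F(U) in N_F(Q) and of N_F(Q) in N_F(M), where M is
  \<open>O_p\<close> of N_F(Q).\<close>

lemma subsystem_trans:
  assumes "group (grp C)" "subsystem A B" "subsystem B C"
  shows "subsystem A C"
proof -
  interpret group "grp C" by fact
  from assms have B: "subgroup (carrier (grp B)) (grp C)"
      "grp B = (grp C)\<lparr>carrier := carrier (grp B)\<rparr>"
    and A: "subgroup (carrier (grp A)) (grp B)"
      "grp A = (grp B)\<lparr>carrier := carrier (grp A)\<rparr>"
    and M: "\<And>X Y. Mor A X Y \<subseteq> Mor B X Y" "\<And>X Y. Mor B X Y \<subseteq> Mor C X Y"
    by (simp_all only: subsystem_def)
  have "subgroup (carrier (grp A)) ((grp C)\<lparr>carrier := carrier (grp B)\<rparr>)"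
    using A(1) B(2) by simp
  then have "subgroup (carrier (grp A)) (grp C)"
    by (rule incl_subgroup[OF B(1)])
  moreover have "grp A = (grp C)\<lparr>carrier := carrier (grp A)\<rparr>"
    by (subst A(2), subst B(2)) simp
  ultimately show ?thesis
    unfolding subsystem_def using M by blast
qed

context hom_system
begin

lemma hom_system_normalizer_fs:
  assumes "subgroup P (grp E)"
  shows "hom_system (normalizer_fs E P)"
proof -
  have "group ((grp E)\<lparr>carrier := normalizer (grp E) P\<rparr>)"
    using subgroup_imp_group[OF subgroup_normalizer[OF assms]] .
  then show ?thesis
    using Mor_hom by (auto simp: hom_system_def hom_system_axioms_def mem_Mor_normalizer_fs)
qed

lemma subsystem_normalizer_fs:
  assumes "subgroup P (grp E)"
  shows "subsystem (normalizer_fs E P) E"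
  using subgroup_normalizer[OF assms]
  by (auto simp: subsystem_def mem_Mor_normalizer_fs)

text \<open>Once X and Y contain P, the products XP and YP collapse to X and Y, so a morphism
  stabilising P serves as its own extension.\<close>

lemma mem_Mor_normalizer_fsI:
  assumes "h \<in> Mor E X Y" "subgroup P (grp E)" "P \<subseteq> X" "P \<subseteq> Y" "h ` P = P"
    and "subgroup X ((grp E)\<lparr>carrier := normalizer (grp E) P\<rparr>)"
    and "subgroup Y ((grp E)\<lparr>carrier := normalizer (grp E) P\<rparr>)"
  shows "h \<in> Mor (normalizer_fs E P) X Y"
proof -
  have "X <#>\<^bsub>grp E\<^esub> P = X" "Y <#>\<^bsub>grp E\<^esub> P = Y"
    using Mor_subgroup[OF assms(1)] subgroup.one_closed[OF assms(2)] assms(3,4)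
    by (simp_all add: set_mult_absorb_right)
  then show ?thesis
    using assms by (auto simp: mem_Mor_normalizer_fs)
qed

text \<open>Comparing the records E and N_E(P) field by field: equal groups mean that P is normal in
  the group of E, equal morphism sets mean that every morphism has an extension stabilising
  P.\<close>

lemma normal_in_fs_iff:
  "normal_in_fs P E \<longleftrightarrow> P \<lhd> grp E \<and>
     (\<forall>X Y. \<forall>f \<in> Mor E X Y. \<exists>h \<in> Mor E (X <#>\<^bsub>grp E\<^esub> P) (Y <#>\<^bsub>grp E\<^esub> P). (\<forall>x\<in>X. h x = f x) \<and> h ` P = P)"
  (is "_ \<longleftrightarrow> _ \<and> ?ext")
proof
  assume *: "normal_in_fs P E"
  then have P: "subgroup P (grp E)" and E: "E = normalizer_fs E P"
    by (simp_all add: normal_in_fs_def)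
  have "carrier (grp E) = normalizer (grp E) P"
    using arg_cong[OF E, of "\<lambda>e. carrier (grp e)"] by simp
  moreover have ?ext
    using E mem_Mor_normalizer_fs[of _ E P] by metis
  ultimately show "P \<lhd> grp E \<and> ?ext"
    using normalizer_eq_carrier_iff[OF P] by simp
next
  assume *: "P \<lhd> grp E \<and> ?ext"
  then have P: "subgroup P (grp E)" and eq: "(grp E)\<lparr>carrier := normalizer (grp E) P\<rparr> = grp E"
    using normalizer_eq_carrier_iff by (auto simp: normal_inv_iff)
  have "Mor (normalizer_fs E P) = Mor E"
    by (intro ext set_eqI) (use * Mor_subgroup in \<open>auto simp: mem_Mor_normalizer_fs eq\<close>)
  then have "E = normalizer_fs E P"
    by (simp add: fusion.equality eq)
  then show "normal_in_fs P E"
    using P by (simp add: normal_in_fs_def)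
qed

text \<open>An extension g of f to XP stabilising P is extended once more, to h on XPR stabilising
  R. As h agrees with g on XP, it still stabilises P; being multiplicative, it stabilises
  PR.\<close>

lemma normal_in_fs_set_mult:
  assumes "normal_in_fs P E" "normal_in_fs R E"
  shows "normal_in_fs (P <#>\<^bsub>grp E\<^esub> R) E"
  unfolding normal_in_fs_iff
proof (intro conjI allI ballI)
  have P: "P \<lhd> grp E" and R: "R \<lhd> grp E"
    using assms by (auto simp: normal_in_fs_iff)
  then show "P <#>\<^bsub>grp E\<^esub> R \<lhd> grp E" by (rule normal_set_mult)
  have P': "subgroup P (grp E)" "P \<subseteq> carrier (grp E)"
    and R': "subgroup R (grp E)" "R \<subseteq> carrier (grp E)"
    using P R by (auto simp: normal_inv_iff dest: subgroup.subset)
  fix X Y f assume f: "f \<in> Mor E X Y"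
  then have X: "subgroup X (grp E)" "X \<subseteq> carrier (grp E)"
    and Y: "subgroup Y (grp E)" "Y \<subseteq> carrier (grp E)"
    using Mor_subgroup[OF f] by (auto dest: subgroup.subset)
  obtain g where g: "g \<in> Mor E (X <#>\<^bsub>grp E\<^esub> P) (Y <#>\<^bsub>grp E\<^esub> P)" "\<forall>x\<in>X. g x = f x" "g ` P = P"
    using assms(1) f unfolding normal_in_fs_iff by blast
  obtain h where h: "h \<in> Mor E (X <#>\<^bsub>grp E\<^esub> P <#>\<^bsub>grp E\<^esub> R) (Y <#>\<^bsub>grp E\<^esub> P <#>\<^bsub>grp E\<^esub> R)" "\<forall>x\<in>X <#>\<^bsub>grp E\<^esub> P. h x = g x"
      "h ` R = R"
    using assms(2) g(1) unfolding normal_in_fs_iff by blast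
  have assoc: "X <#>\<^bsub>grp E\<^esub> P <#>\<^bsub>grp E\<^esub> R = X <#>\<^bsub>grp E\<^esub> (P <#>\<^bsub>grp E\<^esub> R)" "Y <#>\<^bsub>grp E\<^esub> P <#>\<^bsub>grp E\<^esub> R = Y <#>\<^bsub>grp E\<^esub> (P <#>\<^bsub>grp E\<^esub> R)"
    using X Y P' R' by (simp_all add: set_mult_assoc)
  have PX: "P \<subseteq> X <#>\<^bsub>grp E\<^esub> P" and XX: "X \<subseteq> X <#>\<^bsub>grp E\<^esub> P"
    using subset_set_mult_right[OF P'(2) X(1)] subset_set_mult_left[OF X(2) P'(1)] by auto
  have XP: "subgroup (X <#>\<^bsub>grp E\<^esub> P) (grp E)"
    using subgroup_set_mult_normal[OF X(1) P] .
  \<comment> \<open>Both factors must lie in the domain of \<open>h\<close> before its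
    multiplicativity can be applied on PR.\<close>
  have "P \<subseteq> X <#>\<^bsub>grp E\<^esub> P <#>\<^bsub>grp E\<^esub> R"
    using PX subset_set_mult_left[OF subgroup.subset[OF XP] R'(1)] by auto
  moreover have "R \<subseteq> X <#>\<^bsub>grp E\<^esub> P <#>\<^bsub>grp E\<^esub> R"
    using subset_set_mult_right[OF R'(2) XP] .
  ultimately have "h (a \<otimes>\<^bsub>grp E\<^esub> b) = h a \<otimes>\<^bsub>grp E\<^esub> h b" if "a \<in> P" "b \<in> R" for a b
    using that Mor_hom[OF h(1)] by (simp add: hom_def subset_iff)
  then have "h ` (P <#>\<^bsub>grp E\<^esub> R) = h ` P <#>\<^bsub>grp E\<^esub> h ` R"
    by (force simp: set_mult_def)
  moreover have "h ` P = P"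
    using h(2) g(3) PX by (metis image_cong subsetD)
  ultimately have "h ` (P <#>\<^bsub>grp E\<^esub> R) = P <#>\<^bsub>grp E\<^esub> R"
    using h(3) by simp
  moreover have "\<forall>x\<in>X. h x = f x"
    using XX g(2) h(2) by auto
  ultimately show "\<exists>h \<in> Mor E (X <#>\<^bsub>grp E\<^esub> (P <#>\<^bsub>grp E\<^esub> R)) (Y <#>\<^bsub>grp E\<^esub> (P <#>\<^bsub>grp E\<^esub> R)).
      (\<forall>x\<in>X. h x = f x) \<and> h ` (P <#>\<^bsub>grp E\<^esub> R) = P <#>\<^bsub>grp E\<^esub> R"
    using h(1) assoc by auto
qed

text \<open>\<open>GREATEST\<close> is meaningful only if a greatest element exists. By finiteness
  there is a maximal normal M; for any normal P the product MP is again normal, so maximality forces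
  MP = M and P \<le> M.\<close>

lemma O_p_greatest:
  assumes "finite (carrier (grp E))" "normal_in_fs Q E"
  shows "normal_in_fs (O_p E) E" "Q \<subseteq> O_p E"
proof -
  let ?N = "{P. normal_in_fs P E}"
  have "?N \<subseteq> Pow (carrier (grp E))"
    by (auto simp: normal_in_fs_def dest: subgroup.subset)
  then have "finite ?N" using assms(1) finite_subset by blast
  then obtain M where M: "normal_in_fs M E" "\<And>P. normal_in_fs P E \<Longrightarrow> M \<subseteq> P \<Longrightarrow> M = P"
    using finite_has_maximal[of ?N] assms(2) by auto
  have "P \<subseteq> M" if P: "normal_in_fs P E" for P
  proof -
    have PM: "subgroup P (grp E)" "subgroup M (grp E)"
      using P M(1) by (simp_all add: normal_in_fs_def)
    have "M = M <#>\<^bsub>grp E\<^esub> P"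
      using M(2)[OF normal_in_fs_set_mult[OF M(1) P]]
        subset_set_mult_left[OF subgroup.subset[OF PM(2)] PM(1)] by simp
    then show ?thesis
      using subset_set_mult_right[OF subgroup.subset[OF PM(1)] PM(2)] by simp
  qed
  then have "O_p E = M"
    unfolding O_p_def using M(1) by (intro Greatest_equality) auto
  then show "normal_in_fs (O_p E) E" "Q \<subseteq> O_p E"
    using M(1) \<open>\<And>P. normal_in_fs P E \<Longrightarrow> P \<subseteq> M\<close> assms(2) by auto
qed

text \<open>The extension h witnessing that f lies in N_E(P) lies there itself, because XP and YP
  contain P and h stabilises P.\<close>

lemma normal_in_normalizer_fs:
  assumes P: "subgroup P (grp E)"
  shows "normal_in_fs P (normalizer_fs E P)"
proof -
  let ?N = "normalizer (grp E) P"
  interpret N: hom_system "normalizer_fs E P" by (rule hom_system_normalizer_fs[OF P])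
  have norm: "P \<lhd> (grp E)\<lparr>carrier := ?N\<rparr>"
    by (rule subgroup_in_normalizer[OF P])
  have P1: "P \<subseteq> carrier (grp E)" "\<one>\<^bsub>grp E\<^esub> \<in> P"
    using P by (auto dest: subgroup.subset subgroup.one_closed)
  show ?thesis
    unfolding N.normal_in_fs_iff
  proof (intro conjI allI ballI)
    show "P \<lhd> grp (normalizer_fs E P)" using norm by simp
    fix X Y f assume "f \<in> Mor (normalizer_fs E P) X Y"
    then obtain h where f: "f \<in> Mor E X Y"
      and XN: "subgroup X (grp (normalizer_fs E P))"
      and YN: "subgroup Y (grp (normalizer_fs E P))"
      and h: "h \<in> Mor E (X <#>\<^bsub>grp E\<^esub> P) (Y <#>\<^bsub>grp E\<^esub> P)" "\<forall>x\<in>X. h x = f x" "h ` P = P"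
      by (auto simp: mem_Mor_normalizer_fs)
    have X: "subgroup X (grp E)" and Y: "subgroup Y (grp E)"
      using Mor_subgroup[OF f] by auto
    have "subgroup (X <#>\<^bsub>grp E\<^esub> P) ((grp E)\<lparr>carrier := ?N\<rparr>)"
      "subgroup (Y <#>\<^bsub>grp E\<^esub> P) ((grp E)\<lparr>carrier := ?N\<rparr>)"
      using N.subgroup_set_mult_normal[OF XN] N.subgroup_set_mult_normal[OF YN] norm by simp_all
    then have "h \<in> Mor (normalizer_fs E P) (X <#>\<^bsub>grp E\<^esub> P) (Y <#>\<^bsub>grp E\<^esub> P)"
      using mem_Mor_normalizer_fsI[OF h(1) P subset_set_mult_right[OF P1(1) X]
          subset_set_mult_right[OF P1(1) Y] h(3)] by simp
    then show "\<exists>h\<in>Mor (normalizer_fs E P) (X <#>\<^bsub>grp (normalizer_fs E P)\<^esub> P)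
        (Y <#>\<^bsub>grp (normalizer_fs E P)\<^esub> P). (\<forall>x\<in>X. h x = f x) \<and> h ` P = P"
      using h by auto
  qed
qed

text \<open>Extensions found inside D are also morphisms of E, so they witness membership in N_E(P).
  This turns normality of P in a subsystem into the inclusion that largeness demands.\<close>

lemma subsystem_normalizer_fs_if_normal:
  assumes "hom_system D" "subsystem D E" "normal_in_fs P D"
  shows "subsystem D (normalizer_fs E P)"
proof -
  interpret D: hom_system D by fact
  let ?T = "carrier (grp D)" and ?N = "normalizer (grp E) P"
  have T: "subgroup ?T (grp E)" and D: "grp D = (grp E)\<lparr>carrier := ?T\<rparr>"
    and Mor: "\<And>X Y. Mor D X Y \<subseteq> Mor E X Y"
    using assms(2) by (auto simp only: subsystem_def)
  have norm: "P \<lhd> grp D" using assms(3) D.normal_in_fs_iff by blast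
  \<comment> \<open>P is normal in the group T of D, hence T lies in the normalizer of P in the
    larger group.\<close>
  then have "P \<lhd> (grp E)\<lparr>carrier := ?T\<rparr>" using D by simp
  then have TN: "subgroup ?T ((grp E)\<lparr>carrier := ?N\<rparr>)"
    by (rule normal_imp_subgroup_normalizer[OF T])
  have "subgroup P (grp D)" using norm by (simp add: D.normal_inv_iff)
  then have P: "subgroup P (grp E)" using incl_subgroup[OF T] D by simp
  interpret N: group "(grp E)\<lparr>carrier := ?N\<rparr>"
    using subgroup_imp_group[OF subgroup_normalizer[OF P]] .
  have up: "subgroup X ((grp E)\<lparr>carrier := ?N\<rparr>)" if "subgroup X (grp D)" for X
    using N.incl_subgroup[OF TN, of X] that D by simp
  \<comment> \<open>Both groups share their multiplication, so XP does not depend on which of them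
    it is formed in.\<close>
  have mult: "X <#>\<^bsub>grp D\<^esub> P = X <#>\<^bsub>grp E\<^esub> P" for X
    by (subst D) simp
  have "f \<in> Mor (normalizer_fs E P) X Y" if f: "f \<in> Mor D X Y" for f X Y
  proof -
    obtain h where "h \<in> Mor D (X <#>\<^bsub>grp E\<^esub> P) (Y <#>\<^bsub>grp E\<^esub> P)" "\<forall>x\<in>X. h x = f x" "h ` P = P"
      using assms(3) f unfolding D.normal_in_fs_iff mult by blast
    then have "\<exists>h \<in> Mor E (X <#>\<^bsub>grp E\<^esub> P) (Y <#>\<^bsub>grp E\<^esub> P). (\<forall>x\<in>X. h x = f x) \<and> h ` P = P"
      using Mor by blast
    moreover have "f \<in> Mor E X Y" using Mor f by blast
    ultimately show ?thesis
      using up D.Mor_subgroup[OF f] by (simp add: mem_Mor_normalizer_fs)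
  qed
  then show ?thesis
    using TN D by (auto simp: subsystem_def)
qed

end

section \<open>Large subgroups\<close>

lemma large_imp_normal:
  assumes "prime p" "fusion_system_over p S F" "large F Q"
  shows "Q \<lhd> S"
proof -
  have p: "finite_p_group p S" and F: "grp F = S"
    using assms(2) by (auto simp: fusion_system_over_def)
  interpret group S using p by (simp add: finite_p_group_def)
  have Q: "subgroup Q S" "centralizer S Q \<subseteq> Q"
    using assms(3) F by (auto simp: large_def)
  let ?Z = "centralizer S (carrier S)"
  show ?thesis
  proof (cases "carrier S = {\<one>\<^bsub>S\<^esub>}")
    \<comment> \<open>Here the centre of S is trivial and cannot serve as U; instead Q = S holds
      outright.\<close>
    case True
    then have "Q = carrier S"
      using subgroup.subset[OF Q(1)] subgroup.one_closed[OF Q(1)] by auto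
    then show ?thesis by (simp add: normal_inv_iff subgroup_self)
  next
    case False
    have Z: "subgroup ?Z S" by (simp add: subgroup_centralizer)
    have "?Z \<lhd> S" by (rule normal_if_centralized[OF Z]) simp
    then have NZ: "normalizer S ?Z = carrier S"
      using normalizer_eq_carrier_iff[OF Z] by simp
    \<comment> \<open>Z(S) centralises Q, hence lies in C_S(Q) \<le> Q and so in Z(Q).\<close>
    have "?Z \<subseteq> centralizer S Q"
      using subgroup.subset[OF Q(1)] by (auto simp: centralizer_def)
    then have "?Z \<subseteq> center_of S Q"
      using Q(2) by (auto simp: center_of_def)
    then have "subsystem (normalizer_fs F ?Z) (normalizer_fs F Q)"
      using assms(3) Z F finite_p_group_nontrivial_center[OF assms(1) p False]
      by (simp add: large_def)
    then have "subgroup (carrier S) (S\<lparr>carrier := normalizer S Q\<rparr>)"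
      using NZ F by (simp add: subsystem_def)
    then have "carrier S \<subseteq> normalizer S Q"
      using subgroup.subset by fastforce
    then have "normalizer S Q = carrier S"
      using subgroup.subset[OF subgroup_normalizer[OF Q(1)]] by auto
    then show ?thesis using normalizer_eq_carrier_iff[OF Q(1)] by simp
  qed
qed

text \<open>Largeness applied directly to f would give an extension to XQ with no control over the
  image of U, which need not lie in X. Extending f to XU first puts U into the domain and fixes its
  image.\<close>

lemma large_imp_normal_in_normalizer_fs:
  assumes "prime p" "fusion_system_over p S F" "large F Q"
    and U: "subgroup U S" "U \<noteq> {\<one>\<^bsub>S\<^esub>}" "U \<subseteq> center_of S Q"
  shows "normal_in_fs Q (normalizer_fs F U)"
proof -
  have F: "grp F = S" using assms(2) by (auto simp: fusion_system_over_def)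
  interpret F: hom_system F using fusion_system_over_imp_hom_system[OF assms(2)] .
  interpret group S using F.group_axioms F by simp
  let ?N = "S\<lparr>carrier := normalizer S U\<rparr>" and ?E = "normalizer_fs F U"
  interpret N: hom_system ?E using F.hom_system_normalizer_fs U(1) F by simp
  have grp_E: "grp ?E = ?N" using F by simp
  have Q: "subgroup Q S" using assms(3) F by (auto simp: large_def)
  have norm: "Q \<lhd> S" by (rule large_imp_normal[OF assms(1-3)])
  have sub: "subsystem ?E (normalizer_fs F Q)"
    using assms(3) U F by (simp add: large_def)
  have UQ: "U \<subseteq> Q" using U(3) by (auto simp: center_of_def)
  have U1: "U \<subseteq> carrier S" "\<one>\<^bsub>S\<^esub> \<in> U" and Q1: "Q \<subseteq> carrier S" "\<one>\<^bsub>S\<^esub> \<in> Q"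
    using U(1) Q by (auto dest: subgroup.subset subgroup.one_closed)
  interpret Q: group "S\<lparr>carrier := Q\<rparr>" using subgroup_imp_group[OF Q] .
  \<comment> \<open>U is central in Q, so Q normalises U and is a subgroup of the group underlying
    N_F(U).\<close>
  have "U \<lhd> S\<lparr>carrier := Q\<rparr>"
  proof (rule Q.normal_if_centralized)
    show "subgroup U (S\<lparr>carrier := Q\<rparr>)" using subgroup_incl[OF U(1) Q UQ] .
    show "U \<subseteq> centralizer (S\<lparr>carrier := Q\<rparr>) (carrier (S\<lparr>carrier := Q\<rparr>))"
      using U(3) by (auto simp: center_of_def centralizer_def)
  qed
  then have QN: "subgroup Q ?N" by (rule normal_imp_subgroup_normalizer[OF Q])
  have NS: "subgroup (normalizer S U) S" by (rule subgroup_normalizer[OF U(1)])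
  have norm_U: "U \<lhd> ?N" by (rule subgroup_in_normalizer[OF U(1)])
  \<comment> \<open>Normality of Q passes from S down to N_S(U), once inverses in the two groups are
    identified.\<close>
  have norm_Q: "Q \<lhd> ?N"
    unfolding N.normal_inv_iff[unfolded grp_E]
  proof (intro conjI ballI QN)
    fix x h assume "x \<in> carrier ?N" "h \<in> Q"
    moreover from this have "x \<in> carrier S" using subgroup.subset[OF NS] by auto
    ultimately show "x \<otimes>\<^bsub>?N\<^esub> h \<otimes>\<^bsub>?N\<^esub> inv\<^bsub>?N\<^esub> x \<in> Q"
      using norm m_inv_consistent[OF NS, of x] by (simp add: normal_inv_iff)
  qed
  show ?thesis
    unfolding N.normal_in_fs_iff
  proof (intro conjI allI ballI)
    show "Q \<lhd> grp ?E" using norm_Q by (simp only: grp_E)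
    fix X Y f assume f: "f \<in> Mor ?E X Y"
    then obtain g where XN: "subgroup X ?N" and YN: "subgroup Y ?N"
      and g: "g \<in> Mor F (X <#>\<^bsub>S\<^esub> U) (Y <#>\<^bsub>S\<^esub> U)" "\<forall>x\<in>X. g x = f x" "g ` U = U"
      using F by (auto simp: mem_Mor_normalizer_fs)
    have X: "subgroup X S" "X \<subseteq> carrier S" and Y: "subgroup Y S" "Y \<subseteq> carrier S"
      using incl_subgroup[OF NS] XN YN by (auto dest: subgroup.subset)
    have mult: "subgroup (A <#>\<^bsub>S\<^esub> B) ?N" if "subgroup A ?N" "B \<lhd> ?N" for A B
      using N.subgroup_set_mult_normal[of A B] that F by simp
    \<comment> \<open>The domain of \<open>g\<close> contains U and \<open>g\<close> stabilises U,
      so \<open>g\<close> itself belongs to N_F(U) and largeness applies to it.\<close>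
    have "g \<in> Mor ?E (X <#>\<^bsub>S\<^esub> U) (Y <#>\<^bsub>S\<^esub> U)"
      using mult[OF XN norm_U] mult[OF YN norm_U] g U(1)
        subset_set_mult_right[OF U1(1) X(1)] subset_set_mult_right[OF U1(1) Y(1)] F
      by (intro F.mem_Mor_normalizer_fsI) simp_all
    then have "g \<in> Mor (normalizer_fs F Q) (X <#>\<^bsub>S\<^esub> U) (Y <#>\<^bsub>S\<^esub> U)"
      using sub by (auto simp: subsystem_def)
    then obtain h where h: "h \<in> Mor F (X <#>\<^bsub>S\<^esub> U <#>\<^bsub>S\<^esub> Q) (Y <#>\<^bsub>S\<^esub> U <#>\<^bsub>S\<^esub> Q)"
        "\<forall>x\<in>X <#>\<^bsub>S\<^esub> U. h x = g x" "h ` Q = Q"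
      using F by (auto simp: mem_Mor_normalizer_fs)
    \<comment> \<open>UQ = Q because U \<le> Q.\<close>
    have "X <#>\<^bsub>S\<^esub> U <#>\<^bsub>S\<^esub> Q = X <#>\<^bsub>S\<^esub> Q" "Y <#>\<^bsub>S\<^esub> U <#>\<^bsub>S\<^esub> Q = Y <#>\<^bsub>S\<^esub> Q"
      using X Y U1 Q1 set_mult_absorb_left[OF Q UQ U1(2)] by (simp_all add: set_mult_assoc)
    with h(1) have hQ: "h \<in> Mor F (X <#>\<^bsub>S\<^esub> Q) (Y <#>\<^bsub>S\<^esub> Q)" by simp
    \<comment> \<open>U lies in XU, where \<open>h\<close> agrees with \<open>g\<close>; hence
      \<open>h\<close> is a morphism of N_F(U) and not merely of F.\<close>
    have "h ` U = g ` U"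
      using h(2) subset_set_mult_right[OF U1(1) X(1)] by (intro image_cong) auto
    then have "h \<in> Mor ?E (X <#>\<^bsub>S\<^esub> Q) (Y <#>\<^bsub>S\<^esub> Q)"
      using mult[OF XN norm_Q] mult[OF YN norm_Q] hQ g(3) U(1) F UQ
        subset_set_mult_right[OF Q1(1) X(1)] subset_set_mult_right[OF Q1(1) Y(1)]
      by (intro F.mem_Mor_normalizer_fsI) auto
    moreover have "\<forall>x\<in>X. h x = f x"
      using h(2) g(2) subset_set_mult_left[OF X(2) U(1)] by auto
    ultimately show "\<exists>h\<in>Mor ?E (X <#>\<^bsub>grp ?E\<^esub> Q) (Y <#>\<^bsub>grp ?E\<^esub> Q).
        (\<forall>x\<in>X. h x = f x) \<and> h ` Q = Q"
      using h(3) F by auto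
  qed
qed

theorem lemma4p3:
  fixes p :: nat and S :: "'a monoid" and F :: "'a fusion" and Q :: "'a set"
  assumes "prime p"
    and "fusion_system_over p S F"
    and "large F Q"
  shows "large F (O_p (normalizer_fs F Q)) \<and>
    (\<forall>U. subgroup U S \<longrightarrow> U \<noteq> {\<one>\<^bsub>S\<^esub>} \<longrightarrow> U \<subseteq> center_of S Q \<longrightarrow>
       normal_in_fs Q (normalizer_fs F U)) \<and>
    Q \<lhd> S \<and>
    (\<forall>R. large F R \<longrightarrow> large F (Q <#>\<^bsub>S\<^esub> R))"
proof (intro conjI allI impI)
  have F: "grp F = S" and "finite_p_group p S"
    using assms(2) by (auto simp: fusion_system_over_def)
  then have fin: "finite (carrier S)" by (simp add: finite_p_group_def)
  interpret F: hom_system F using fusion_system_over_imp_hom_system[OF assms(2)] .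
  interpret group S using F.group_axioms F by simp
  have Q: "subgroup Q S" "centralizer S Q \<subseteq> Q"
    using assms(3) F by (auto simp: large_def)
  show norm: "Q \<lhd> S" by (rule large_imp_normal[OF assms])
  \<comment> \<open>What centralises M centralises its subset A, hence lies in C_S(A) \<le> A. So a
    central subgroup of an overgroup of Q is already central in Q, and largeness of Q applies to
    it.\<close>
  have center: "U \<subseteq> center_of S A"
    if "A \<subseteq> M" "centralizer S A \<subseteq> A" "U \<subseteq> center_of S M" for A M U
  proof -
    have "U \<subseteq> centralizer S A"
      using that(1,3) by (auto simp: center_of_def centralizer_def)
    then show ?thesis
      using that(2) by (auto simp: center_of_def)
  qed
  show "normal_in_fs Q (normalizer_fs F U)"
    if "subgroup U S" "U \<noteq> {\<one>\<^bsub>S\<^esub>}" "U \<subseteq> center_of S Q" for U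
    using large_imp_normal_in_normalizer_fs[OF assms that] .
  show "large F (O_p (normalizer_fs F Q))"
  proof -
    let ?E = "normalizer_fs F Q"
    let ?M = "O_p ?E"
    interpret E: hom_system ?E using F.hom_system_normalizer_fs Q(1) F by simp
    \<comment> \<open>Since Q is normal in S, the system N_F(Q) lives over all of S.\<close>
    have E: "grp ?E = S" using normalizer_eq_carrier_iff[OF Q(1)] norm F by simp
    have "normal_in_fs Q ?E" using F.normal_in_normalizer_fs[of Q] Q(1) F by simp
    moreover have "finite (carrier (grp ?E))" using fin by (simp only: E)
    ultimately have M: "normal_in_fs ?M ?E" "Q \<subseteq> ?M"
      using E.O_p_greatest by blast+
    have M_sub: "subgroup ?M S" using M(1) E by (simp add: normal_in_fs_def)
    have "centralizer S ?M \<subseteq> ?M"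
      using M(2) Q(2) by (force simp: centralizer_def)
    moreover have "subsystem (normalizer_fs F U) (normalizer_fs F ?M)"
      if U: "subgroup U S" "U \<noteq> {\<one>\<^bsub>S\<^esub>}" "U \<subseteq> center_of S ?M" for U
    proof (rule subsystem_trans)
      show "group (grp (normalizer_fs F ?M))"
        using hom_system.axioms(1)[OF F.hom_system_normalizer_fs] M_sub F by blast
      show "subsystem (normalizer_fs F U) ?E"
        using assms(3) U center[OF M(2) Q(2) U(3)] F by (simp add: large_def)
      \<comment> \<open>M is normal in N_F(Q), so N_F(Q) lies in N_F(M).\<close>
      show "subsystem ?E (normalizer_fs F ?M)"
        using F.subsystem_normalizer_fs_if_normal[OF E.hom_system_axioms
            F.subsystem_normalizer_fs M(1)] Q(1) F by simp
    qed
    ultimately show ?thesis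
      using M_sub F by (simp add: large_def)
  qed
  show "large F (Q <#>\<^bsub>S\<^esub> R)" if large_R: "large F R" for R
  proof -
    let ?M = "Q <#>\<^bsub>S\<^esub> R"
    have R: "subgroup R S" "centralizer S R \<subseteq> R"
      using large_R F by (auto simp: large_def)
    have QM: "Q \<subseteq> ?M" and RM: "R \<subseteq> ?M"
      using subset_set_mult_left[of Q R] subset_set_mult_right[of R Q] Q(1) R(1) subgroup.subset
      by blast+
    \<comment> \<open>QR is a subgroup because Q and R, both being large, are normal in S.\<close>
    have M_sub: "subgroup ?M S"
      using normal_set_mult[OF norm large_imp_normal[OF assms(1,2) large_R]]
      by (simp add: normal_inv_iff)
    have "centralizer S ?M \<subseteq> ?M"
      using QM Q(2) by (force simp: centralizer_def)
    moreover have "subsystem (normalizer_fs F U) (normalizer_fs F ?M)"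
      if U: "subgroup U S" "U \<noteq> {\<one>\<^bsub>S\<^esub>}" "U \<subseteq> center_of S ?M" for U
    proof -
      let ?E = "normalizer_fs F U"
      interpret E: hom_system ?E using F.hom_system_normalizer_fs U(1) F by simp
      \<comment> \<open>U is central in Q and in R, since QR contains both; so both are normal in
        N_F(U), and with them their product.\<close>
      have "normal_in_fs Q ?E"
        using large_imp_normal_in_normalizer_fs[OF assms U(1,2) center[OF QM Q(2) U(3)]] .
      moreover have "normal_in_fs R ?E"
        using large_imp_normal_in_normalizer_fs[OF assms(1,2) large_R U(1,2) center[OF RM R(2) U(3)]] .
      ultimately have "normal_in_fs ?M ?E"
        using E.normal_in_fs_set_mult F by simp
      then show ?thesis
        using F.subsystem_normalizer_fs_if_normal[OF E.hom_system_axioms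
            F.subsystem_normalizer_fs] U(1) F by simp
    qed
    ultimately show ?thesis
      using M_sub F by (simp add: large_def)
  qed
qed

end
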